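(* Let $\alpha,\beta,\gamma\in\mathbb{R}$ with $\gamma\neq 0$, and let $(G_2,g,J)$ be the connected, simply connected three-dimensional Lie group with left-invariant Lorentzian metric $g$ whose Lie algebra $\mathfrak{g}$ has a pseudo-orthonormal basis $\{e_1,e_2,e_3\}$ with $e_3$ timelike such that $$[e_1,e_2]=\gamma e_2-\beta e_3,\quad [e_1,e_3]=-\beta e_2-\gamma e_3,\quad [e_2,e_3]=\alpha e_1,$$ equipped with the product structure $Je_1=e_1$, $Je_2=e_2$, $Je_3=-e_3$. Let $c\in\mathbb{R}$. Then $(G_2,g,J)$ is a second kind algebraic Wanas soliton associated to the canonical connection $\nabla^0$ with constant $c$ (i.e. $\widetilde{\mathrm{Wan}}^0=c\,\mathrm{Id}+D$ with $D$ a derivation of $\mathfrak g$) if and only if $\alpha=\beta=0$, $2\gamma^2+c=0$ and $\gamma\neq 0$. In particular, in this case $De_1=0$, $De_2=\gamma^2e_2$, $De_3=2\gamma^2e_3$.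
   Context: Pseudo-orthonormal with $e_3$ timelike means $g(e_1,e_1)=g(e_2,e_2)=1$, $g(e_3,e_3)=-1$, $g(e_i,e_j)=0$ for $i\ne j$. All tensors are left-invariant and evaluated on the Lie algebra $\mathfrak{g}$ of left-invariant vector fields. Let $\nabla$ be the Levi-Civita connection of $g$, and let $J$ be the product structure given in the claim, with $(\nabla_XJ)Y=\nabla_X(JY)-J(\nabla_XY)$. Canonical connection: $\nabla^0_XY=\nabla_XY-\frac12(\nabla_XJ)JY$. Curvature: $R^0(X,Y)Z=\nabla^0_X\nabla^0_YZ-\nabla^0_Y\nabla^0_XZ-\nabla^0_{[X,Y]}Z$. Torsion: $T^0(X,Y)=\nabla^0_XY-\nabla^0_YX-[X,Y]$. $A^0(X,Y)Z=T^0(T^0(X,Y),Z)$, and the Wanas tensor is $W^0(X,Y)Z=R^0(X,Y)Z-A^0(X,Y)Z$. $w^0(X,Y)=-g(W^0(X,e_1)Y,e_1)-g(W^0(X,e_2)Y,e_2)+g(W^0(X,e_3)Y,e_3)$. $\widetilde w^0(X,Y)=\frac12\big(w^0(X,Y)+w^0(Y,X)\big)$, and the operator $\widetilde{\mathrm{Wan}}^0:\mathfrak g\to\mathfrak g$ is defined by $\widetilde w^0(X,Y)=g(\widetilde{\mathrm{Wan}}^0(X),Y)$. A derivation of $\mathfrak g$ is a linear map $D$ with $D[X,Y]=[DX,Y]+[X,DY]$ for all $X,Y\in\mathfrak g$. $(G_2,g,J)$ is a second kind algebraic Wanas soliton associated to $\nabla^0$ (with constant $c$) if $\widetilde{\mathrm{Wan}}^0=c\,\mathrm{Id}+D$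 for the real number $c$ and a derivation $D$ of $\mathfrak g$. *)

theory Defs
  imports "HOL-Analysis.Analysis"
begin

text \<open>
  Left-invariant objects on a connected, simply connected Lie group are represented by their
  values on the Lie algebra of left-invariant vector fields: a real vector space with bracket
  \<open>br\<close>, metric \<open>g\<close> and product structure \<open>J\<close>.
  Functions of left-invariant fields such as \<open>g(Y, Z)\<close> are constant, so the terms differentiating
  them drop out of metric compatibility.
\<close>

definition lie_algebra :: "('v::real_vector \<Rightarrow> 'v \<Rightarrow> 'v) \<Rightarrow> bool" where
  "lie_algebra br \<longleftrightarrow> bilinear br \<and> (\<forall>X. br X X = 0) \<and>
     (\<forall>X Y Z. br X (br Y Z) + br Y (br Z X) + br Z (br X Y) = 0)"

definition lie_derivation :: "('v::real_vector \<Rightarrow> 'v \<Rightarrow> 'v) \<Rightarrow> ('v \<Rightarrow> 'v) \<Rightarrow> bool" where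
  "lie_derivation br D \<longleftrightarrow> linear D \<and> (\<forall>X Y. D (br X Y) = br (D X) Y + br X (D Y))"

definition symmetric_bilinear_form :: "('v::real_vector \<Rightarrow> 'v \<Rightarrow> real) \<Rightarrow> bool" where
  "symmetric_bilinear_form g \<longleftrightarrow> bilinear g \<and> (\<forall>X Y. g X Y = g Y X)"

text \<open>The third vector is timelike; a symmetric bilinear form with such a basis is Lorentzian.\<close>

definition pseudo_orthonormal_basis ::
  "('v::real_vector \<Rightarrow> 'v \<Rightarrow> real) \<Rightarrow> 'v \<Rightarrow> 'v \<Rightarrow> 'v \<Rightarrow> bool" where
  "pseudo_orthonormal_basis g e1 e2 e3 \<longleftrightarrow>
     independent {e1, e2, e3} \<and> span {e1, e2, e3} = UNIV \<and>
     g e1 e1 = 1 \<and> g e2 e2 = 1 \<and> g e3 e3 = -1 \<and>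
     g e1 e2 = 0 \<and> g e1 e3 = 0 \<and> g e2 e3 = 0"

definition is_levi_civita ::
  "('v::real_vector \<Rightarrow> 'v \<Rightarrow> 'v) \<Rightarrow> ('v \<Rightarrow> 'v \<Rightarrow> real) \<Rightarrow> ('v \<Rightarrow> 'v \<Rightarrow> 'v) \<Rightarrow> bool" where
  "is_levi_civita br g nab \<longleftrightarrow> bilinear nab \<and>
     (\<forall>X Y. nab X Y - nab Y X = br X Y) \<and>
     (\<forall>X Y Z. g (nab X Y) Z + g Y (nab X Z) = 0)"

definition levi_civita ::
  "('v::real_vector \<Rightarrow> 'v \<Rightarrow> 'v) \<Rightarrow> ('v \<Rightarrow> 'v \<Rightarrow> real) \<Rightarrow> 'v \<Rightarrow> 'v \<Rightarrow> 'v" where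
  "levi_civita br g = (THE nab. is_levi_civita br g nab)"

definition cov_deriv_J ::
  "('v::real_vector \<Rightarrow> 'v \<Rightarrow> 'v) \<Rightarrow> ('v \<Rightarrow> 'v) \<Rightarrow> 'v \<Rightarrow> 'v \<Rightarrow> 'v" where
  "cov_deriv_J nab J X Y = nab X (J Y) - J (nab X Y)"

definition canonical_connection ::
  "('v::real_vector \<Rightarrow> 'v \<Rightarrow> 'v) \<Rightarrow> ('v \<Rightarrow> 'v \<Rightarrow> real) \<Rightarrow> ('v \<Rightarrow> 'v) \<Rightarrow> 'v \<Rightarrow> 'v \<Rightarrow> 'v" where
  "canonical_connection br g J X Y =
     levi_civita br g X Y - (1/2) *\<^sub>R cov_deriv_J (levi_civita br g) J X (J Y)"

definition curvature ::
  "('v::real_vector \<Rightarrow> 'v \<Rightarrow> 'v) \<Rightarrow> ('v \<Rightarrow> 'v \<Rightarrow> 'v) \<Rightarrow> 'v \<Rightarrow> 'v \<Rightarrow> 'v \<Rightarrow> 'v" where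
  "curvature br nab X Y Z = nab X (nab Y Z) - nab Y (nab X Z) - nab (br X Y) Z"

definition torsion ::
  "('v::real_vector \<Rightarrow> 'v \<Rightarrow> 'v) \<Rightarrow> ('v \<Rightarrow> 'v \<Rightarrow> 'v) \<Rightarrow> 'v \<Rightarrow> 'v \<Rightarrow> 'v" where
  "torsion br nab X Y = nab X Y - nab Y X - br X Y"

definition wanas_tensor ::
  "('v::real_vector \<Rightarrow> 'v \<Rightarrow> 'v) \<Rightarrow> ('v \<Rightarrow> 'v \<Rightarrow> 'v) \<Rightarrow> 'v \<Rightarrow> 'v \<Rightarrow> 'v \<Rightarrow> 'v" where
  "wanas_tensor br nab X Y Z =
     curvature br nab X Y Z - torsion br nab (torsion br nab X Y) Z"

definition wanas_form ::
  "('v::real_vector \<Rightarrow> 'v \<Rightarrow> 'v) \<Rightarrow> ('v \<Rightarrow> 'v \<Rightarrow> real) \<Rightarrow> ('v \<Rightarrow> 'v \<Rightarrow> 'v) \<Rightarrow>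
    'v \<Rightarrow> 'v \<Rightarrow> 'v \<Rightarrow> 'v \<Rightarrow> 'v \<Rightarrow> real" where
  "wanas_form br g nab e1 e2 e3 X Y =
     - g (wanas_tensor br nab X e1 Y) e1
     - g (wanas_tensor br nab X e2 Y) e2
     + g (wanas_tensor br nab X e3 Y) e3"

definition sym_wanas_form ::
  "('v::real_vector \<Rightarrow> 'v \<Rightarrow> 'v) \<Rightarrow> ('v \<Rightarrow> 'v \<Rightarrow> real) \<Rightarrow> ('v \<Rightarrow> 'v \<Rightarrow> 'v) \<Rightarrow>
    'v \<Rightarrow> 'v \<Rightarrow> 'v \<Rightarrow> 'v \<Rightarrow> 'v \<Rightarrow> real" where
  "sym_wanas_form br g nab e1 e2 e3 X Y =
     (1/2) * (wanas_form br g nab e1 e2 e3 X Y + wanas_form br g nab e1 e2 e3 Y X)"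

definition sym_wanas_operator ::
  "('v::real_vector \<Rightarrow> 'v \<Rightarrow> 'v) \<Rightarrow> ('v \<Rightarrow> 'v \<Rightarrow> real) \<Rightarrow> ('v \<Rightarrow> 'v \<Rightarrow> 'v) \<Rightarrow>
    'v \<Rightarrow> 'v \<Rightarrow> 'v \<Rightarrow> 'v \<Rightarrow> 'v" where
  "sym_wanas_operator br g nab e1 e2 e3 =
     (THE W. \<forall>X Y. sym_wanas_form br g nab e1 e2 e3 X Y = g (W X) Y)"

definition second_kind_wanas_decomposition ::
  "('v::real_vector \<Rightarrow> 'v \<Rightarrow> 'v) \<Rightarrow> ('v \<Rightarrow> 'v \<Rightarrow> real) \<Rightarrow> ('v \<Rightarrow> 'v) \<Rightarrow>
    'v \<Rightarrow> 'v \<Rightarrow> 'v \<Rightarrow> real \<Rightarrow> ('v \<Rightarrow> 'v) \<Rightarrow> bool" where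
  "second_kind_wanas_decomposition br g J e1 e2 e3 c D \<longleftrightarrow>
     lie_derivation br D \<and>
     (\<forall>X. sym_wanas_operator br g (canonical_connection br g J) e1 e2 e3 X = c *\<^sub>R X + D X)"

definition second_kind_algebraic_wanas_soliton ::
  "('v::real_vector \<Rightarrow> 'v \<Rightarrow> 'v) \<Rightarrow> ('v \<Rightarrow> 'v \<Rightarrow> real) \<Rightarrow> ('v \<Rightarrow> 'v) \<Rightarrow>
    'v \<Rightarrow> 'v \<Rightarrow> 'v \<Rightarrow> real \<Rightarrow> bool" where
  "second_kind_algebraic_wanas_soliton br g J e1 e2 e3 c \<longleftrightarrow>
     (\<exists>D. second_kind_wanas_decomposition br g J e1 e2 e3 c D)"

end

theory Submission
  imports Defs
begin

text \<open>
  In the coordinates of the basis, Koszul's formula gives the Levi-Civita connection, and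
  \<open>\<nabla>\<^sup>0\<^sub>X Y = \<theta>(X) (y\<^sub>2 e\<^sub>1 - y\<^sub>1 e\<^sub>2)\<close> with \<open>\<theta>(X) = \<gamma> x\<^sub>2 - (\<alpha>/2) x\<^sub>3\<close>. The derivation equation for
  \<open>[e\<^sub>1, e\<^sub>2]\<close> then forces \<open>c = -(2\<gamma>\<^sup>2 + \<alpha>\<beta> + \<beta>\<^sup>2)\<close>. Substituted into the equation for
  \<open>[e\<^sub>2, e\<^sub>3]\<close>, this gives \<open>\<alpha> (6\<gamma>\<^sup>2 + 2\<beta>\<^sup>2 + (\<alpha> - 2\<beta>)\<^sup>2) = 0\<close>, so \<open>\<alpha> = 0\<close>, and what remains is
  \<open>\<beta> (2\<gamma>\<^sup>2 + \<beta>\<^sup>2) = 0\<close>.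
\<close>

text \<open>With brackets written as \<open>nab A B - nab B A\<close>, three cyclic instances of
  metric compatibility cancel everything but the left side. As \<open>nab\<close> is absent from the
  right side, this yields uniqueness of the connection.\<close>

lemma koszul:
  assumes "symmetric_bilinear_form g" "is_levi_civita br g nab"
  shows "2 * g (nab X Y) Z = g (br X Y) Z - g (br Y Z) X + g (br Z X) Y"
proof -
  have bil: "bilinear g" and sym: "\<And>X Y. g X Y = g Y X"
    using assms(1) by (auto simp: symmetric_bilinear_form_def)
  have tor: "br A B = nab A B - nab B A" and met: "g (nab A B) C = - g (nab A C) B" for A B C
    using assms(2) sym by (auto simp: is_levi_civita_def eq_neg_iff_add_eq_0)
  show ?thesis
    using met[of X Y Z] met[of Y Z X] met[of Z X Y]
    by (simp add: tor bilinear_lsub[OF bil])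
qed

section \<open>Coordinates in a pseudo-orthonormal frame\<close>

locale pseudo_orthonormal_frame =
  fixes g :: "'v::real_vector \<Rightarrow> 'v \<Rightarrow> real" and e1 e2 e3 :: 'v
  assumes metric: "symmetric_bilinear_form g"
    and basis: "pseudo_orthonormal_basis g e1 e2 e3"
begin

definition vec :: "real \<Rightarrow> real \<Rightarrow> real \<Rightarrow> 'v" where
  "vec a b c = a *\<^sub>R e1 + b *\<^sub>R e2 + c *\<^sub>R e3"

lemma bilinear_metric: "bilinear g"
  and metric_sym: "g X Y = g Y X"
  using metric by (auto simp: symmetric_bilinear_form_def)

lemma vec_frame: "vec 1 0 0 = e1" "vec 0 1 0 = e2" "vec 0 0 1 = e3"
  by (simp_all add: vec_def)

lemma vec_arith [simp]:
  "vec a b c + vec a' b' c' = vec (a + a') (b + b') (c + c')"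
  "vec a b c - vec a' b' c' = vec (a - a') (b - b') (c - c')"
  "- vec a b c = vec (- a) (- b) (- c)"
  "r *\<^sub>R vec a b c = vec (r * a) (r * b) (r * c)"
  by (simp_all add: vec_def algebra_simps)

text \<open>Oriented so that zero vectors enter coordinate form, where \<open>vec_arith\<close>
  applies.\<close>

lemma vec_0: "0 = vec 0 0 0"
  by (simp add: vec_def)

lemma linear_vec:
  assumes "linear f"
  shows "f (vec a b c) = a *\<^sub>R f e1 + b *\<^sub>R f e2 + c *\<^sub>R f e3"
  using assms by (simp add: vec_def linear_add linear_scale)

lemma bilinear_vec:
  assumes "bilinear h"
  shows "h (vec a b c) (vec a' b' c') =
    a *\<^sub>R (a' *\<^sub>R h e1 e1 + b' *\<^sub>R h e1 e2 + c' *\<^sub>R h e1 e3) +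
    b *\<^sub>R (a' *\<^sub>R h e2 e1 + b' *\<^sub>R h e2 e2 + c' *\<^sub>R h e2 e3) +
    c *\<^sub>R (a' *\<^sub>R h e3 e1 + b' *\<^sub>R h e3 e2 + c' *\<^sub>R h e3 e3)"
proof -
  have "linear (h X)" "linear (\<lambda>X. h X Y)" for X Y
    using assms by (auto simp: bilinear_def)
  then show ?thesis
    by (simp add: linear_vec[of "h _"] linear_vec[of "\<lambda>X. h X _"] algebra_simps)
qed

lemma g_vec [simp]: "g (vec a b c) (vec a' b' c') = a * a' + b * b' - c * c'"
  using basis metric_sym[of e2 e1] metric_sym[of e3 e1] metric_sym[of e3 e2]
  by (simp add: bilinear_vec[OF bilinear_metric] pseudo_orthonormal_basis_def)

lemma vec_eq_iff [simp]: "vec a b c = vec a' b' c' \<longleftrightarrow> a = a' \<and> b = b' \<and> c = c'"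
proof
  assume "vec a b c = vec a' b' c'"
  \<comment> \<open>Pairing with the three basis vectors recovers the coordinates, the third up to
    sign.\<close>
  then have "g (vec a b c) (vec x y z) = g (vec a' b' c') (vec x y z)" for x y z
    by simp
  from this[of 1 0 0] this[of 0 1 0] this[of 0 0 1] show "a = a' \<and> b = b' \<and> c = c'"
    by simp
qed simp

lemma vec_cases: obtains a b c where "X = vec a b c"
proof -
  have "X \<in> span {e1, e2, e3}"
    using basis by (simp add: pseudo_orthonormal_basis_def)
  then obtain a b c where "X - a *\<^sub>R e1 - b *\<^sub>R e2 - c *\<^sub>R e3 = 0"
    unfolding span_breakdown_eq span_empty by blast
  then have "X = vec a b c"
    by (simp add: vec_def algebra_simps)
  then show ?thesis
    by (rule that)
qed

lemma g_nondegenerate: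
  assumes "\<And>Z. g X Z = g Y Z"
  shows "X = Y"
proof (cases X rule: vec_cases, cases Y rule: vec_cases)
  fix a b c a' b' c'
  assume "X = vec a b c" "Y = vec a' b' c'"
  then show ?thesis
    using assms[of "vec 1 0 0"] assms[of "vec 0 1 0"] assms[of "vec 0 0 1"] by simp
qed

text \<open>Koszul's formula gives any two candidates the same pairings, so nondegeneracy identifies
  them; exhibiting one connection resolves the \<open>THE\<close>.\<close>

lemma levi_civita_eqI:
  assumes "is_levi_civita br g nab"
  shows "levi_civita br g = nab"
  unfolding levi_civita_def
proof (rule the_equality)
  show "nab' = nab" if "is_levi_civita br g nab'" for nab'
  proof (intro ext g_nondegenerate)
    fix X Y Z
    show "g (nab' X Y) Z = g (nab X Y) Z"
      using koszul[OF metric that, of X Y Z] koszul[OF metric assms, of X Y Z] by simp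
  qed
qed (fact assms)

lemma sym_wanas_operator_eqI:
  assumes "\<And>X Y. sym_wanas_form br g nab e1 e2 e3 X Y = g (W X) Y"
  shows "sym_wanas_operator br g nab e1 e2 e3 = W"
  unfolding sym_wanas_operator_def
proof (rule the_equality)
  show "W' = W" if "\<forall>X Y. sym_wanas_form br g nab e1 e2 e3 X Y = g (W' X) Y" for W'
    using that assms by (intro ext g_nondegenerate) auto
qed (use assms in blast)

lemma wanas_form_vec:
  "wanas_form br g nab e1 e2 e3 X Y =
     - g (wanas_tensor br nab X (vec 1 0 0) Y) (vec 1 0 0)
     - g (wanas_tensor br nab X (vec 0 1 0) Y) (vec 0 1 0)
     + g (wanas_tensor br nab X (vec 0 0 1) Y) (vec 0 0 1)"
  by (simp add: wanas_form_def vec_frame)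

text \<open>Inverse of \<open>vec\<close>, read off by the metric; the minus sign compensates for
  \<open>g e3 e3 = -1\<close>.\<close>

definition coord :: "'v \<Rightarrow> real \<times> real \<times> real" where
  "coord X = (g X (vec 1 0 0), g X (vec 0 1 0), - g X (vec 0 0 1))"

lemma coord_vec [simp]: "coord (vec a b c) = (a, b, c)"
  by (simp add: coord_def)

end

section \<open>The Lie algebra, its connections, torsion and curvature\<close>

locale g2_algebra = pseudo_orthonormal_frame g e1 e2 e3
  for g :: "'v::real_vector \<Rightarrow> 'v \<Rightarrow> real" and e1 e2 e3 :: 'v +
  fixes \<alpha> \<beta> \<gamma> :: real and br :: "'v \<Rightarrow> 'v \<Rightarrow> 'v" and J :: "'v \<Rightarrow> 'v"
  assumes lie: "lie_algebra br"
    and br12: "br e1 e2 = \<gamma> *\<^sub>R e2 - \<beta> *\<^sub>R e3"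
    and br13: "br e1 e3 = - \<beta> *\<^sub>R e2 - \<gamma> *\<^sub>R e3"
    and br23: "br e2 e3 = \<alpha> *\<^sub>R e1"
    and J_linear: "linear J"
    and J1: "J e1 = e1" and J2: "J e2 = e2" and J3: "J e3 = - e3"
begin

lemma bilinear_br: "bilinear br" and br_self: "br X X = 0"
  using lie by (auto simp: lie_algebra_def)

lemma br_skew: "br Y X = - br X Y"
proof -
  have "br X Y + br Y X = 0"
    using br_self[of "X + Y"]
    unfolding bilinear_ladd[OF bilinear_br] bilinear_radd[OF bilinear_br]
    by (simp add: br_self add.commute)
  then show ?thesis
    by (metis add.commute eq_neg_iff_add_eq_0)
qed

lemma br_vec [simp]:
  "br (vec a b c) (vec a' b' c') =
    vec (\<alpha> * (b * c' - c * b'))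
        (\<gamma> * (a * b' - b * a') - \<beta> * (a * c' - c * a'))
        (- \<beta> * (a * b' - b * a') - \<gamma> * (a * c' - c * a'))"
proof -
  have "br e1 e2 = vec 0 \<gamma> (- \<beta>)" "br e1 e3 = vec 0 (- \<beta>) (- \<gamma>)" "br e2 e3 = vec \<alpha> 0 0"
    by (simp_all add: vec_def br12 br13 br23)
  then show ?thesis
    unfolding bilinear_vec[OF bilinear_br] br_self
      br_skew[of e2 e1] br_skew[of e3 e1] br_skew[of e3 e2]
    by (simp add: vec_0) (simp add: algebra_simps)
qed

lemma J_vec [simp]: "J (vec a b c) = vec a b (- c)"
  by (simp add: linear_vec[OF J_linear] J1 J2 J3) (simp add: vec_def)

text \<open>Koszul's formula solved on the basis and extended bilinearly.\<close>

definition lc :: "'v \<Rightarrow> 'v \<Rightarrow> 'v" where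
  "lc X Y = (case (coord X, coord Y) of ((x1, x2, x3), (y1, y2, y3)) \<Rightarrow>
    vec (\<gamma> * (x2 * y2 + x3 * y3) + (\<alpha>/2) * (x2 * y3 - x3 * y2))
        ((\<alpha>/2 - \<beta>) * x1 * y3 - (\<gamma> * x2 - (\<alpha>/2) * x3) * y1)
        ((\<alpha>/2 - \<beta>) * x1 * y2 + ((\<alpha>/2) * x2 + \<gamma> * x3) * y1))"

lemma lc_vec [simp]:
  "lc (vec x1 x2 x3) (vec y1 y2 y3) =
    vec (\<gamma> * (x2 * y2 + x3 * y3) + (\<alpha>/2) * (x2 * y3 - x3 * y2))
        ((\<alpha>/2 - \<beta>) * x1 * y3 - (\<gamma> * x2 - (\<alpha>/2) * x3) * y1)
        ((\<alpha>/2 - \<beta>) * x1 * y2 + ((\<alpha>/2) * x2 + \<gamma> * x3) * y1)"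
  by (simp add: lc_def)

lemma is_levi_civita_lc: "is_levi_civita br g lc"
  unfolding is_levi_civita_def bilinear_def
proof (intro conjI allI linearI)
  fix X Y Z :: 'v and r :: real
  obtain x1 x2 x3 y1 y2 y3 z1 z2 z3
    where [simp]: "X = vec x1 x2 x3" "Y = vec y1 y2 y3" "Z = vec z1 z2 z3"
    by (metis vec_cases)
  show "lc X (Y + Z) = lc X Y + lc X Z" "lc (Y + Z) X = lc Y X + lc Z X"
    "lc X (r *\<^sub>R Y) = r *\<^sub>R lc X Y" "lc (r *\<^sub>R Y) X = r *\<^sub>R lc Y X"
    "lc X Y - lc Y X = br X Y" "g (lc X Y) Z + g Y (lc X Z) = 0"
    by (simp_all, simp_all add: algebra_simps add_divide_distrib diff_divide_distrib)
qed

text \<open>Since \<open>J\<close> is an involution, \<nabla>0_X is the half-sum of \<nabla>_X and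
  its conjugate by \<open>J\<close>: the blocks on span(e1, e2) and span(e3) survive. Skewness makes
  the first a rotation generator and the second zero.\<close>

lemma canonical_connection_vec [simp]:
  "canonical_connection br g J (vec x1 x2 x3) (vec y1 y2 y3) =
    vec ((\<gamma> * x2 - (\<alpha>/2) * x3) * y2) (- (\<gamma> * x2 - (\<alpha>/2) * x3) * y1) 0"
  unfolding canonical_connection_def cov_deriv_J_def levi_civita_eqI[OF is_levi_civita_lc]
  by (simp, simp add: field_simps)

lemma torsion_vec:
  "torsion br (canonical_connection br g J) (vec x1 x2 x3) (vec y1 y2 y3) =
    vec (- (\<alpha>/2) * (x2 * y3 - x3 * y2))
        ((\<beta> - \<alpha>/2) * (x1 * y3 - x3 * y1))
        (\<beta> * (x1 * y2 - x2 * y1) + \<gamma> * (x1 * y3 - x3 * y1))"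
  unfolding torsion_def
  by (simp only: br_vec canonical_connection_vec vec_arith vec_eq_iff) (intro conjI; algebra)

text \<open>All \<open>\<nabla>\<^sup>0\<^sub>X\<close> are multiples of one rotation, so they commute and only \<open>-\<nabla>\<^sup>0\<close> along \<open>[X, Y]\<close> survives.\<close>

lemma curvature_eq:
  "curvature br (canonical_connection br g J) X Y Z = - canonical_connection br g J (br X Y) Z"
proof -
  obtain x1 x2 x3 y1 y2 y3 z1 z2 z3
    where coords: "X = vec x1 x2 x3" "Y = vec y1 y2 y3" "Z = vec z1 z2 z3"
    by (metis vec_cases)
  show ?thesis
    unfolding coords curvature_def
    by (simp only: br_vec canonical_connection_vec vec_arith vec_eq_iff) (intro conjI; algebra)
qed

section \<open>The symmetrized Wanas operator\<close>

text \<open>The symmetrized form on the basis with one index raised. Raising flips the sign of the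
  e3 component, so the two mixed entries are opposite although the operator is self-adjoint for
  \<open>g\<close>.\<close>

definition wan :: "'v \<Rightarrow> 'v" where
  "wan X = (case coord X of (x1, x2, x3) \<Rightarrow>
    vec ((\<alpha> * \<beta> / 2 - 2 * \<gamma>\<^sup>2 - 2 * \<beta>\<^sup>2) * x1)
        ((- \<gamma>\<^sup>2 - 3 * \<alpha> * \<beta> / 2) * x2 + (\<beta> * \<gamma> / 2 - 3 * \<alpha> * \<gamma> / 4) * x3)
        ((3 * \<alpha> * \<gamma> / 4 - \<beta> * \<gamma> / 2) * x2 + (\<alpha>\<^sup>2 / 2 - \<alpha> * \<beta>) * x3))"

lemma wan_vec [simp]:
  "wan (vec x1 x2 x3) =
    vec ((\<alpha> * \<beta> / 2 - 2 * \<gamma>\<^sup>2 - 2 * \<beta>\<^sup>2) * x1)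
        ((- \<gamma>\<^sup>2 - 3 * \<alpha> * \<beta> / 2) * x2 + (\<beta> * \<gamma> / 2 - 3 * \<alpha> * \<gamma> / 4) * x3)
        ((3 * \<alpha> * \<gamma> / 4 - \<beta> * \<gamma> / 2) * x2 + (\<alpha>\<^sup>2 / 2 - \<alpha> * \<beta>) * x3)"
  by (simp add: wan_def)

lemma sym_wanas_operator_eq:
  "sym_wanas_operator br g (canonical_connection br g J) e1 e2 e3 = wan"
proof (rule sym_wanas_operator_eqI)
  fix X Y
  obtain x1 x2 x3 y1 y2 y3 where coords: "X = vec x1 x2 x3" "Y = vec y1 y2 y3"
    by (metis vec_cases)
  show "sym_wanas_form br g (canonical_connection br g J) e1 e2 e3 X Y = g (wan X) Y"
    unfolding coords sym_wanas_form_def wanas_form_vec wanas_tensor_def curvature_eq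
    by (simp add: torsion_vec)
      (simp add: algebra_simps power2_eq_square add_divide_distrib diff_divide_distrib)
qed

text \<open>With the operator known, \<open>D\<close> is determined by \<open>c\<close>, so the
  soliton condition asks whether one explicit map is a derivation.\<close>

lemma wanas_decomposition_iff:
  "second_kind_wanas_decomposition br g J e1 e2 e3 c D \<longleftrightarrow>
    lie_derivation br D \<and> D = (\<lambda>X. wan X - c *\<^sub>R X)"
  by (auto simp: second_kind_wanas_decomposition_def sym_wanas_operator_eq fun_eq_iff)

section \<open>Solving the derivation equations\<close>

lemma wanas_derivation_constants:
  assumes "\<gamma> \<noteq> 0" "lie_derivation br (\<lambda>X. wan X - c *\<^sub>R X)"
  shows "\<alpha> = 0" "\<beta> = 0" "c = - 2 * \<gamma>\<^sup>2"
proof -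
  define D where "D = (\<lambda>X. wan X - c *\<^sub>R X)"
  have D: "g (D (br X Y)) Z = g (br (D X) Y + br X (D Y)) Z" for X Y Z
    using assms(2) by (auto simp: lie_derivation_def D_def)
  \<comment> \<open>A label ijk marks the derivation equation for [e_i, e_j] paired with e_k, up to
    a nonzero factor.\<close>
  have 122: "2 * \<gamma>^3 + \<alpha> * \<beta> * \<gamma> + \<beta>\<^sup>2 * \<gamma> + \<gamma> * c = 0"
    using D[of "vec 1 0 0" "vec 0 1 0" "vec 0 1 0"]
    by (simp add: D_def) (simp add: algebra_simps power2_eq_square power3_eq_cube
        add_divide_distrib diff_divide_distrib)
  have 231: "2 * \<alpha> * \<gamma>\<^sup>2 + 4 * \<alpha> * \<beta>\<^sup>2 - 6 * \<alpha>\<^sup>2 * \<beta> + \<alpha>^3 - 2 * \<alpha> * c = 0"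
    using D[of "vec 0 1 0" "vec 0 0 1" "vec 1 0 0"]
    by (simp add: D_def) (simp add: algebra_simps power2_eq_square power3_eq_cube
        add_divide_distrib diff_divide_distrib)
  have 123: "3 * \<alpha> * \<gamma>\<^sup>2 - 8 * \<beta> * \<gamma>\<^sup>2 - \<alpha>\<^sup>2 * \<beta> - 4 * \<beta>^3 - 2 * \<beta> * c = 0"
    using D[of "vec 1 0 0" "vec 0 1 0" "vec 0 0 1"]
    by (simp add: D_def) (simp add: algebra_simps power2_eq_square power3_eq_cube
        add_divide_distrib diff_divide_distrib)
  have "\<gamma> * (2 * \<gamma>\<^sup>2 + \<alpha> * \<beta> + \<beta>\<^sup>2 + c) = 0"
    using 122 by algebra
  then have "2 * \<gamma>\<^sup>2 + \<alpha> * \<beta> + \<beta>\<^sup>2 + c = 0"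
    using assms(1) by (metis mult_eq_0_iff)
  then have c: "c = - (2 * \<gamma>\<^sup>2 + \<alpha> * \<beta> + \<beta>\<^sup>2)"
    by linarith
  \<comment> \<open>Substituting \<open>c\<close> gives the cofactor \<open>6 * \<gamma>\<^sup>2 + 6
    * \<beta>\<^sup>2 - 4 * \<alpha> * \<beta> + \<alpha>\<^sup>2\<close>; completing the square
    shows that it is positive.\<close>
  have "\<alpha> * (6 * \<gamma>\<^sup>2 + 2 * \<beta>\<^sup>2 + (\<alpha> - 2 * \<beta>)\<^sup>2) = 0"
    using 231 unfolding c by algebra
  moreover have "6 * \<gamma>\<^sup>2 + 2 * \<beta>\<^sup>2 + (\<alpha> - 2 * \<beta>)\<^sup>2 > 0"
    using assms(1) by (intro add_pos_nonneg) auto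
  ultimately show \<alpha>: "\<alpha> = 0"
    by (metis less_irrefl mult_eq_0_iff)
  \<comment> \<open>This is the negative of equation 123 at \<alpha> = 0 with \<open>c\<close>
    substituted.\<close>
  have "2 * (\<beta> * (2 * \<gamma>\<^sup>2 + \<beta>\<^sup>2)) = 0"
    using 123 \<alpha> unfolding c by algebra
  then have "\<beta> * (2 * \<gamma>\<^sup>2 + \<beta>\<^sup>2) = 0"
    by linarith
  moreover have "2 * \<gamma>\<^sup>2 + \<beta>\<^sup>2 > 0"
    using assms(1) by (intro add_pos_nonneg) auto
  ultimately show "\<beta> = 0"
    by (metis less_irrefl mult_eq_0_iff)
  then show "c = - 2 * \<gamma>\<^sup>2"
    using c \<alpha> by simp
qed

text \<open>Here \<open>wan\<close> is diagonal with entries \<open>- 2 * \<gamma>\<^sup>2\<close>,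
  \<open>- \<gamma>\<^sup>2\<close>, 0, and subtracting \<open>c\<close> shifts each by
  \<open>2 * \<gamma>\<^sup>2\<close>.\<close>

lemma wanas_derivation_vec:
  assumes "\<alpha> = 0" "\<beta> = 0" "c = - 2 * \<gamma>\<^sup>2"
  shows "wan (vec x1 x2 x3) - c *\<^sub>R vec x1 x2 x3 = vec 0 (\<gamma>\<^sup>2 * x2) (2 * \<gamma>\<^sup>2 * x3)"
  by (simp, simp add: assms)

text \<open>The brackets are now [e1, e2] = \<gamma> e2, [e1, e3] = -\<gamma> e3, [e2, e3] = 0, for
  which every diagonal map killing e1 is a derivation.\<close>

lemma lie_derivation_wanas:
  assumes "\<alpha> = 0" "\<beta> = 0" "c = - 2 * \<gamma>\<^sup>2"
  shows "lie_derivation br (\<lambda>X. wan X - c *\<^sub>R X)"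
proof -
  define D where "D = (\<lambda>X. wan X - c *\<^sub>R X)"
  have D_vec: "D (vec x1 x2 x3) = vec 0 (\<gamma>\<^sup>2 * x2) (2 * \<gamma>\<^sup>2 * x3)" for x1 x2 x3
    unfolding D_def by (rule wanas_derivation_vec[OF assms])
  have "lie_derivation br D"
    unfolding lie_derivation_def
  proof (intro conjI allI linearI)
    fix X Y and r :: real
    obtain x1 x2 x3 y1 y2 y3 where coords: "X = vec x1 x2 x3" "Y = vec y1 y2 y3"
      by (metis vec_cases)
    show "D (X + Y) = D X + D Y" "D (r *\<^sub>R X) = r *\<^sub>R D X"
      "D (br X Y) = br (D X) Y + br X (D Y)"
      unfolding coords by (simp_all add: D_vec assms(1,2)) (simp_all add: algebra_simps)
  qed
  then show ?thesis
    by (simp add: D_def)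
qed

end

section \<open>Classification of the solitons and their derivations\<close>

theorem theorem2p9:
  fixes \<alpha> \<beta> \<gamma> c :: real
    and br :: "'v::real_vector \<Rightarrow> 'v \<Rightarrow> 'v"
    and g :: "'v \<Rightarrow> 'v \<Rightarrow> real"
    and J :: "'v \<Rightarrow> 'v"
    and e1 e2 e3 :: 'v
  assumes gamma_nz: "\<gamma> \<noteq> 0"
    and lie: "lie_algebra br"
    and metric: "symmetric_bilinear_form g"
    and basis: "pseudo_orthonormal_basis g e1 e2 e3"
    and br12: "br e1 e2 = \<gamma> *\<^sub>R e2 - \<beta> *\<^sub>R e3"
    and br13: "br e1 e3 = - \<beta> *\<^sub>R e2 - \<gamma> *\<^sub>R e3"
    and br23: "br e2 e3 = \<alpha> *\<^sub>R e1"
    and J_linear: "linear J"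
    and J1: "J e1 = e1" and J2: "J e2 = e2" and J3: "J e3 = - e3"
  shows "(second_kind_algebraic_wanas_soliton br g J e1 e2 e3 c \<longleftrightarrow>
            \<alpha> = 0 \<and> \<beta> = 0 \<and> 2 * \<gamma>\<^sup>2 + c = 0 \<and> \<gamma> \<noteq> 0)
       \<and> (\<forall>D. second_kind_wanas_decomposition br g J e1 e2 e3 c D \<longrightarrow>
            D e1 = 0 \<and> D e2 = \<gamma>\<^sup>2 *\<^sub>R e2 \<and> D e3 = (2 * \<gamma>\<^sup>2) *\<^sub>R e3)"
proof -
  interpret g2_algebra g e1 e2 e3 \<alpha> \<beta> \<gamma> br J
    by (intro g2_algebra.intro pseudo_orthonormal_frame.intro g2_algebra_axioms.intro assms)
  have "second_kind_algebraic_wanas_soliton br g J e1 e2 e3 c \<longleftrightarrow>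
      lie_derivation br (\<lambda>X. wan X - c *\<^sub>R X)"
    by (simp add: second_kind_algebraic_wanas_soliton_def wanas_decomposition_iff)
  also have "\<dots> \<longleftrightarrow> \<alpha> = 0 \<and> \<beta> = 0 \<and> c = - 2 * \<gamma>\<^sup>2"
    using wanas_derivation_constants[OF gamma_nz] lie_derivation_wanas by blast
  also have "\<dots> \<longleftrightarrow> \<alpha> = 0 \<and> \<beta> = 0 \<and> 2 * \<gamma>\<^sup>2 + c = 0 \<and> \<gamma> \<noteq> 0"
    using gamma_nz by auto
  finally have soliton_iff: "second_kind_algebraic_wanas_soliton br g J e1 e2 e3 c \<longleftrightarrow>
      \<alpha> = 0 \<and> \<beta> = 0 \<and> 2 * \<gamma>\<^sup>2 + c = 0 \<and> \<gamma> \<noteq> 0" .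
  have "D e1 = 0 \<and> D e2 = \<gamma>\<^sup>2 *\<^sub>R e2 \<and> D e3 = (2 * \<gamma>\<^sup>2) *\<^sub>R e3"
    if "second_kind_wanas_decomposition br g J e1 e2 e3 c D" for D
  proof -
    \<comment> \<open>A decomposition includes the derivation property, which already forces the
      constants; \<open>D\<close> is then explicit.\<close>
    from that have der: "lie_derivation br (\<lambda>X. wan X - c *\<^sub>R X)"
      and D: "D = (\<lambda>X. wan X - c *\<^sub>R X)"
      by (auto simp: wanas_decomposition_iff)
    have "D (vec x1 x2 x3) = vec 0 (\<gamma>\<^sup>2 * x2) (2 * \<gamma>\<^sup>2 * x3)" for x1 x2 x3
      unfolding D by (rule wanas_derivation_vec[OF wanas_derivation_constants[OF gamma_nz der]])
    from this[of 1 0 0] this[of 0 1 0] this[of 0 0 1] show ?thesis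
      by (simp add: vec_frame) (simp add: vec_def)
  qed
  with soliton_iff show ?thesis
    by blast
qed

end
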